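(* Let $\Delta$ be a positive integer and let $G$ be a finite simple graph of maximum degree at most $\Delta$ without isolated vertices. Then \[ \nu_{ur}(G) \geq \frac{n(G)}{\Delta} - \frac{m(G)}{\Delta^2}, \] with equality if and only if each connected component of $G$ is isomorphic to a complete bipartite graph $K_{\Delta,r}$ for some $r\in\{1,2,\ldots,\Delta\}$.
   Context: All graphs are simple, finite and undirected. A matching in $G$ is a set of pairwise non-adjacent edges. A matching $M$ in $G$ is uniquely restricted if no other matching in $G$ covers exactly the same set of vertices as $M$. $\nu_{ur}(G)$ denotes the maximum size of a uniquely restricted matching in $G$. $n(G)$ and $m(G)$ denote the number of vertices and the number of edges of $G$, respectively. *)

theory Defs
  imports Complex_Main
begin

definition simple_graph :: "'a set \<Rightarrow> 'a set set \<Rightarrow> bool" where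
  "simple_graph V E \<longleftrightarrow> finite V \<and> (\<forall>e\<in>E. e \<subseteq> V \<and> card e = 2)"

definition vertex_degree :: "'a set set \<Rightarrow> 'a \<Rightarrow> nat" where
  "vertex_degree E v = card {e \<in> E. v \<in> e}"

text \<open>Inserting \<open>0\<close> gives the graph without vertices maximum degree \<open>0\<close>.\<close>

definition max_degree :: "'a set \<Rightarrow> 'a set set \<Rightarrow> nat" where
  "max_degree V E = Max (insert 0 (vertex_degree E ` V))"

definition isolated :: "'a set \<Rightarrow> 'a set set \<Rightarrow> 'a \<Rightarrow> bool" where
  "isolated V E v \<longleftrightarrow> v \<in> V \<and> vertex_degree E v = 0"

definition is_matching :: "'a set set \<Rightarrow> 'a set set \<Rightarrow> bool" where
  "is_matching E M \<longleftrightarrow> M \<subseteq> E \<and> (\<forall>e\<in>M. \<forall>f\<in>M. e \<noteq> f \<longrightarrow> e \<inter> f = {})"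

definition uniquely_restricted :: "'a set set \<Rightarrow> 'a set set \<Rightarrow> bool" where
  "uniquely_restricted E M \<longleftrightarrow>
     is_matching E M \<and> (\<forall>M'. is_matching E M' \<and> \<Union>M' = \<Union>M \<longrightarrow> M' = M)"

definition nu_ur :: "'a set set \<Rightarrow> nat" where
  "nu_ur E = Max (card ` {M. uniquely_restricted E M})"

definition reachable :: "'a set set \<Rightarrow> 'a \<Rightarrow> 'a \<Rightarrow> bool" where
  "reachable E u v \<longleftrightarrow> (u, v) \<in> {(x, y). {x, y} \<in> E}\<^sup>*"

text \<open>A connected component is represented by its vertex set; as a graph it is the
  subgraph induced by that set.\<close>

definition graph_components :: "'a set \<Rightarrow> 'a set set \<Rightarrow> 'a set set" where
  "graph_components V E = V // {(u, v). u \<in> V \<and> v \<in> V \<and> reachable E u v}"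

definition induced_edges :: "'a set set \<Rightarrow> 'a set \<Rightarrow> 'a set set" where
  "induced_edges E C = {e \<in> E. e \<subseteq> C}"

definition graph_isomorphic ::
    "'a set \<Rightarrow> 'a set set \<Rightarrow> 'b set \<Rightarrow> 'b set set \<Rightarrow> bool" where
  "graph_isomorphic V E V' E' \<longleftrightarrow>
     (\<exists>f. bij_betw f V V' \<and> (\<forall>u\<in>V. \<forall>v\<in>V. {u, v} \<in> E \<longleftrightarrow> {f u, f v} \<in> E'))"

definition K_verts :: "nat \<Rightarrow> nat \<Rightarrow> (nat + nat) set" where
  "K_verts a b = {..<a} <+> {..<b}"

definition K_edges :: "nat \<Rightarrow> nat \<Rightarrow> (nat + nat) set set" where
  "K_edges a b = {{Inl i, Inr j} | i j. i < a \<and> j < b}"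

end

theory Submission imports Defs begin

text \<open>Let \<open>u\<close> be a vertex of minimum degree \<open>d\<close>, let \<open>N\<close> be its neighbourhood, and let \<open>K\<close> be the
  set of the \<open>k\<close> vertices whose neighbourhood is exactly \<open>N\<close>. Since \<open>d\<close> is minimal, deleting
  \<open>N\<close> isolates only vertices of \<open>K\<close>, so deleting \<open>N\<close> and \<open>K\<close> leaves a graph
  without isolated vertices; adding one edge at \<open>u\<close> to a uniquely restricted matching of it
  gives a uniquely restricted matching again. Now \<open>d + k\<close> vertices and at least \<open>d k\<close> edges
  have been deleted, and the induction closes because \<open>(\<Delta> - d) (\<Delta> - k) \<ge> 0\<close>. Equality
  forces \<open>d = \<Delta>\<close> or \<open>k = \<Delta>\<close>, and that exactly the \<open>d k\<close> edges between \<open>N\<close> and \<open>K\<close> were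
  deleted, so \<open>N \<union> K\<close> is a component of the required kind. Conversely, two matching edges in one
  complete bipartite component can be exchanged for two others on the same vertices.\<close>

section \<open>Neighbourhoods and complete bipartite components\<close>

definition neighbours :: "'a set set \<Rightarrow> 'a \<Rightarrow> 'a set" where
  "neighbours E u = {w. {u, w} \<in> E}"

definition biclique :: "'a set \<Rightarrow> 'a set \<Rightarrow> 'a set set" where
  "biclique A B = {{a, b} | a b. a \<in> A \<and> b \<in> B}"

text \<open>For nonempty \<open>A\<close> and \<open>B\<close> this makes
  \<open>A \<union> B\<close> a connected component. Being local, without reachability, it is easy
  to carry over when other components are deleted.\<close>

definition biclique_component :: "'a set set \<Rightarrow> 'a set \<Rightarrow> 'a set \<Rightarrow> bool" where
  "biclique_component E A B \<longleftrightarrow>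
     A \<inter> B = {} \<and> {e \<in> E. e \<inter> (A \<union> B) \<noteq> {}} = biclique A B"

text \<open>The equality case in the form that both inductions use;
  \<open>biclique_union_iff_components\<close> translates it to components and isomorphisms.\<close>

definition biclique_union :: "nat \<Rightarrow> 'a set \<Rightarrow> 'a set set \<Rightarrow> bool" where
  "biclique_union \<Delta> V E \<longleftrightarrow>
     (\<forall>v\<in>V. \<exists>A B. biclique_component E A B \<and> card A = \<Delta> \<and> card B \<in> {1..\<Delta>} \<and> v \<in> A \<union> B)"

lemma simple_graph_finite_edges:
  assumes "simple_graph V E"
  shows "finite E"
  using assms by (auto simp: simple_graph_def intro: finite_subset[of E "Pow V"])

lemma simple_graph_edgeE:
  assumes "simple_graph V E" "e \<in> E" "x \<in> e"
  obtains y where "e = {x, y}" "x \<noteq> y" "x \<in> V" "y \<in> V"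
proof -
  have "card e = 2" and sub: "e \<subseteq> V" using assms by (auto simp: simple_graph_def)
  then obtain a b where "e = {a, b}" "a \<noteq> b" by (auto simp: card_2_iff)
  then show ?thesis using that assms(3) sub by auto
qed

lemma simple_graph_edgeD:
  assumes "simple_graph V E" "{x, y} \<in> E"
  shows "x \<noteq> y" "x \<in> V" "y \<in> V"
  using assms by (auto simp: simple_graph_def card_insert_if split: if_splits)

lemma neighbours_subset:
  assumes "simple_graph V E"
  shows "neighbours E u \<subseteq> V"
  using simple_graph_edgeD[OF assms] by (auto simp: neighbours_def)

lemma neighbours_sym: "x \<in> neighbours E y \<longleftrightarrow> y \<in> neighbours E x"
  by (simp add: neighbours_def insert_commute)

lemma not_in_own_neighbours:
  assumes "simple_graph V E"
  shows "u \<notin> neighbours E u"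
  using simple_graph_edgeD(1)[OF assms, of u u] by (auto simp: neighbours_def)

lemma card_neighbours:
  assumes "simple_graph V E"
  shows "card (neighbours E u) = vertex_degree E u"
proof -
  have "bij_betw (\<lambda>w. {u, w}) (neighbours E u) {e \<in> E. u \<in> e}"
    unfolding bij_betw_def
  proof
    show "inj_on (\<lambda>w. {u, w}) (neighbours E u)"
      by (auto simp: inj_on_def doubleton_eq_iff)
    show "(\<lambda>w. {u, w}) ` neighbours E u = {e \<in> E. u \<in> e}"
    proof (intro equalityI subsetI)
      fix e assume e: "e \<in> {e \<in> E. u \<in> e}"
      then obtain y where "e = {u, y}" using simple_graph_edgeE[OF assms, of e u] by blast
      then show "e \<in> (\<lambda>w. {u, w}) ` neighbours E u" using e by (simp add: neighbours_def)
    qed (auto simp: neighbours_def)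
  qed
  then show ?thesis by (simp add: vertex_degree_def bij_betw_same_card)
qed

lemma card_biclique:
  assumes "A \<inter> B = {}"
  shows "card (biclique A B) = card A * card B"
proof -
  have "biclique A B = (\<lambda>(a, b). {a, b}) ` (A \<times> B)"
    by (auto simp: biclique_def)
  moreover have "inj_on (\<lambda>(a, b). {a, b}) (A \<times> B)"
    using assms by (auto simp: inj_on_def doubleton_eq_iff)
  ultimately show ?thesis by (simp add: card_image card_cartesian_product)
qed

lemma biclique_commute: "biclique A B = biclique B A"
  by (auto simp: biclique_def)

lemma biclique_component_commute: "biclique_component E A B \<longleftrightarrow> biclique_component E B A"
  by (simp add: biclique_component_def biclique_commute[of A B] Un_commute Int_commute)

text \<open>Vertices are located through their edges, so both sides must be nonempty: with
  \<open>B = {}\<close> the condition only says that no edge meets \<open>A\<close>, which may then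
  lie outside \<open>V\<close>.\<close>

lemma biclique_component_subset:
  assumes "simple_graph V E" "biclique_component E A B" "A \<noteq> {}" "B \<noteq> {}"
  shows "A \<union> B \<subseteq> V"
proof -
  have "{a, b} \<in> E" if "a \<in> A" "b \<in> B" for a b
    using assms(2) that by (auto simp: biclique_component_def biclique_def)
  then show ?thesis using simple_graph_edgeD[OF assms(1)] assms(3,4) by blast
qed

lemma nonempty_obtains_minimizer:
  fixes f :: "'a \<Rightarrow> nat"
  assumes "V \<noteq> {}"
  obtains u where "u \<in> V" "\<And>v. v \<in> V \<Longrightarrow> f u \<le> f v"
proof -
  obtain x where "x \<in> V" using assms by blast
  from ex_has_least_nat[where P = "\<lambda>v. v \<in> V" and m = f, OF this] that show ?thesis by blast
qed

section \<open>The lower bound, by deleting a neighbourhood\<close>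

text \<open>Since \<open>M\<close> avoids the neighbourhood of \<open>u\<close>, the vertex
  \<open>v\<close> is the only covered neighbour of \<open>u\<close>. Every rival matching must
  therefore contain \<open>{u, v}\<close>, and its other edges form a rival of
  \<open>M\<close>.\<close>

lemma uniquely_restricted_insert:
  assumes G: "simple_graph V E" and v: "v \<in> neighbours E u"
    and M: "uniquely_restricted {e \<in> E. e \<inter> neighbours E u = {}} M"
  shows "uniquely_restricted E (insert {u, v} M)" "{u, v} \<notin> M"
proof -
  let ?N = "neighbours E u"
  have uv: "{u, v} \<in> E" using v by (simp add: neighbours_def)
  have ME: "M \<subseteq> E" and MN: "\<And>e. e \<in> M \<Longrightarrow> e \<inter> ?N = {}"
    and disj: "\<And>e f. e \<in> M \<Longrightarrow> f \<in> M \<Longrightarrow> e \<noteq> f \<Longrightarrow> e \<inter> f = {}"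
    using M by (auto simp: uniquely_restricted_def is_matching_def)
  \<comment> \<open>An edge at \<open>u\<close> would have its other end in the neighbourhood that
    \<open>M\<close> avoids.\<close>
  have Mu: "u \<notin> e" if "e \<in> M" for e
  proof
    assume "u \<in> e"
    then obtain y where "e = {u, y}"
      using simple_graph_edgeE[OF G _ \<open>u \<in> e\<close>] ME \<open>e \<in> M\<close> by blast
    then show False using MN[OF that] ME that by (auto simp: neighbours_def)
  qed
  have Mv: "v \<notin> e" if "e \<in> M" for e using MN[OF that] v by blast
  show "{u, v} \<notin> M" using Mu by blast
  show "uniquely_restricted E (insert {u, v} M)"
    unfolding uniquely_restricted_def
  proof (intro conjI allI impI)
    show "is_matching E (insert {u, v} M)"
      using uv ME disj Mu Mv by (auto simp: is_matching_def)
  next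
    fix M2 assume "is_matching E M2 \<and> \<Union>M2 = \<Union>(insert {u, v} M)"
    then have M2E: "M2 \<subseteq> E" and U: "\<Union>M2 = {u, v} \<union> \<Union>M"
      and d2: "\<And>e f. e \<in> M2 \<Longrightarrow> f \<in> M2 \<Longrightarrow> e \<noteq> f \<Longrightarrow> e \<inter> f = {}"
      by (auto simp: is_matching_def)
    obtain e where e: "e \<in> M2" "u \<in> e" using U by blast
    then obtain w where w: "e = {u, w}" "u \<noteq> w"
      using simple_graph_edgeE[OF G _ \<open>u \<in> e\<close>] M2E by blast
    have "w \<in> ?N" using w e M2E by (auto simp: neighbours_def)
    moreover have "w \<in> {u, v} \<union> \<Union>M" using U e w by blast
    ultimately have "w = v" using w MN by blast
    then have uv2: "{u, v} \<in> M2" using w e by simp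
    let ?M3 = "M2 - {{u, v}}"
    have avoid: "f \<inter> {u, v} = {}" if "f \<in> ?M3" for f using d2[OF uv2, of f] that by blast
    have U3: "\<Union>?M3 = \<Union>M"
    proof -
      have "\<Union>?M3 = \<Union>M2 - {u, v}" using avoid by blast
      also have "\<dots> = \<Union>M" using U Mu Mv by blast
      finally show ?thesis .
    qed
    \<comment> \<open>Covering the same vertices as \<open>M\<close>, the rest of \<open>M2\<close>
      also misses the neighbourhood, so the uniqueness of \<open>M\<close> applies to it.\<close>
    have "f \<inter> ?N = {}" if "f \<in> ?M3" for f using U3 that MN by blast
    then have "is_matching {e \<in> E. e \<inter> ?N = {}} ?M3"
      using M2E d2 by (auto simp: is_matching_def)
    then have "?M3 = M" using M U3 by (simp add: uniquely_restricted_def)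
    then show "M2 = insert {u, v} M" using uv2 by blast
  qed
qed

text \<open>The expansion of \<open>(D - d) * (D - k)\<close>, arranged so that the only
  subtractions are exact in the natural numbers.\<close>

lemma product_gap_eq:
  fixes d k D :: nat
  assumes "d \<le> D" "k \<le> D"
  shows "(d + k) * D + (D - d) * (D - k) = d * k + D\<^sup>2"
proof -
  have "int ((D - d) * (D - k)) = (int D - int d) * (int D - int k)"
    using assms by (simp add: of_nat_diff)
  then have "int ((d + k) * D + (D - d) * (D - k)) = int (d * k + D\<^sup>2)"
    by (simp only: of_nat_add of_nat_mult of_nat_power) (simp add: algebra_simps power2_eq_square)
  then show ?thesis by linarith
qed

text \<open>The bound is multiplied by \<open>\<Delta>\<^sup>2\<close> to stay in the natural
  numbers. The equality clause is proved in the same induction because it needs equality for the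
  smaller graph with the very matching found there.\<close>

lemma exists_large_uniquely_restricted:
  assumes "simple_graph V E"
    and "\<And>v. v \<in> V \<Longrightarrow> vertex_degree E v \<in> {1..\<Delta>}"
  shows "\<exists>M. uniquely_restricted E M \<and> card V * \<Delta> \<le> card E + card M * \<Delta>\<^sup>2 \<and>
    (card V * \<Delta> = card E + card M * \<Delta>\<^sup>2 \<longrightarrow> biclique_union \<Delta> V E)"
  using assms
proof (induction "card V" arbitrary: V E rule: less_induct)
  case less
  note G = less.prems(1)
  have finV: "finite V" using G by (simp add: simple_graph_def)
  have finE: "finite E" by (rule simple_graph_finite_edges[OF G])
  show ?case
  proof (cases "V = {}")
    case True
    then have "E = {}" using G by (force simp: simple_graph_def)
    then show ?thesis using True
      by (auto simp: uniquely_restricted_def is_matching_def biclique_union_def intro!: exI[of _ "{}"])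
  next
    case False
    then obtain u where u: "u \<in> V"
      and umin: "\<And>v. v \<in> V \<Longrightarrow> vertex_degree E u \<le> vertex_degree E v"
      using nonempty_obtains_minimizer by metis
    define N where "N = neighbours E u"
    define K where "K = {w \<in> V. neighbours E w = N}"
    define V' where "V' = V - (N \<union> K)"
    \<comment> \<open>Every edge at a vertex of \<open>K\<close> ends in \<open>N\<close>, so
      discarding the edges that meet \<open>N\<close> also clears \<open>K\<close>.\<close>
    define E' where "E' = {e \<in> E. e \<inter> N = {}}"
    have NV: "N \<subseteq> V" and KV: "K \<subseteq> V"
      using neighbours_subset[OF G] by (auto simp: N_def K_def)
    have finN: "finite N" and finK: "finite K" using NV KV finV finite_subset by auto
    have uK: "u \<in> K" using u by (simp add: K_def N_def)
    have NK: "N \<inter> K = {}" using not_in_own_neighbours[OF G] by (auto simp: K_def)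
    have cN: "card N = vertex_degree E u" by (simp add: N_def card_neighbours[OF G])
    have dle: "card N \<le> \<Delta>" and "card N \<ge> 1" using less.prems(2)[OF u] cN by auto
    then obtain v where v: "v \<in> N" by fastforce
    \<comment> \<open>All of \<open>K\<close> is adjacent to the single vertex \<open>v\<close>,
      whose degree is at most \<open>\<Delta>\<close>.\<close>
    have kle: "card K \<le> \<Delta>"
    proof -
      have "K \<subseteq> neighbours E v" using v by (auto simp: K_def neighbours_sym[of _ E v])
      then have "card K \<le> card (neighbours E v)"
        using neighbours_subset[OF G] finV finite_subset card_mono by metis
      also have "\<dots> \<le> \<Delta>" using less.prems(2)[of v] v NV card_neighbours[OF G] by auto
      finally show ?thesis .
    qed
    have E'V': "e \<subseteq> V'" if e: "e \<in> E'" for e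
    proof
      fix x assume "x \<in> e"
      obtain y where y: "e = {x, y}" "x \<in> V" "y \<in> V"
        using simple_graph_edgeE[OF G, of e x] \<open>x \<in> e\<close> e unfolding E'_def by blast
      have "x \<notin> K" using y e by (auto simp: E'_def K_def neighbours_def)
      then show "x \<in> V'" using y e by (auto simp: V'_def E'_def)
    qed
    have G': "simple_graph V' E'"
      using G E'V' finV by (auto simp: simple_graph_def V'_def E'_def)
    have deg': "vertex_degree E' w \<in> {1..\<Delta>}" if "w \<in> V'" for w
    proof -
      have w: "w \<in> V" "w \<notin> N" "w \<notin> K" using that by (auto simp: V'_def)
      have "vertex_degree E' w \<le> vertex_degree E w"
        unfolding vertex_degree_def using finE by (intro card_mono) (auto simp: E'_def)
      also have "\<dots> \<le> \<Delta>" using less.prems(2) w by simp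
      finally have le: "vertex_degree E' w \<le> \<Delta>" .
      \<comment> \<open>If \<open>w\<close> had all its neighbours in \<open>N\<close>, minimality
        of the degree of \<open>u\<close> would make them all of \<open>N\<close>, putting
        \<open>w\<close> into \<open>K\<close>.\<close>
      have "\<not> neighbours E w \<subseteq> N"
      proof
        assume sub: "neighbours E w \<subseteq> N"
        have "card N \<le> card (neighbours E w)" using umin[OF w(1)] cN card_neighbours[OF G] by simp
        then have "neighbours E w = N" using sub finN by (simp add: card_seteq)
        then show False using w by (simp add: K_def)
      qed
      then obtain y where "{w, y} \<in> E'" using w by (auto simp: neighbours_def E'_def)
      then have "{e \<in> E'. w \<in> e} \<noteq> {}" by blast
      moreover have "finite E'" using finE by (simp add: E'_def)
      ultimately have "vertex_degree E' w \<noteq> 0" by (simp add: vertex_degree_def)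
      then show ?thesis using le by simp
    qed
    have VV': "card V = card V' + (card N + card K)"
    proof -
      have "card V = card V' + card (N \<union> K)"
        unfolding V'_def using NV KV finV finN finK
        by (subst card_Diff_subset) (auto simp: card_mono)
      then show ?thesis using NK finN finK by (simp add: card_Un_disjoint)
    qed
    have "card V' < card V" using VV' \<open>card N \<ge> 1\<close> by simp
    from less.hyps[OF this G' deg'] obtain M' where M': "uniquely_restricted E' M'"
      and le': "card V' * \<Delta> \<le> card E' + card M' * \<Delta>\<^sup>2"
      and eq': "card V' * \<Delta> = card E' + card M' * \<Delta>\<^sup>2 \<Longrightarrow> biclique_union \<Delta> V' E'" by blast
    define M where "M = insert {u, v} M'"
    have "finite M'" using M' finE
      by (auto simp: uniquely_restricted_def is_matching_def E'_def intro: finite_subset)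
    then have M: "uniquely_restricted E M" and cM: "card M = card M' + 1"
      using uniquely_restricted_insert[OF G, of v u M'] v M' by (auto simp: N_def E'_def M_def)
    have sub: "biclique N K \<subseteq> E - E'"
    proof
      fix e assume "e \<in> biclique N K"
      then obtain a b where e: "e = {a, b}" "a \<in> N" "b \<in> K" by (auto simp: biclique_def)
      then have "{b, a} \<in> E" by (auto simp: K_def neighbours_def)
      then show "e \<in> E - E'" using e by (auto simp: E'_def insert_commute)
    qed
    have EE': "card E = card E' + card (E - E')"
      using finE by (subst card_Diff_subset) (auto simp: E'_def card_mono finite_subset)
    have lb: "card N * card K \<le> card (E - E')"
      using card_mono[OF _ sub] finE card_biclique[OF NK] by simp
    have gap: "(card N + card K) * \<Delta> + (\<Delta> - card N) * (\<Delta> - card K) = card N * card K + \<Delta>\<^sup>2"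
      by (rule product_gap_eq[OF dle kle])
    \<comment> \<open>Each side is the quantity for the smaller graph plus an increment; the
      \<open>\<Delta>\<^sup>2\<close> in the second increment comes from the new matching
      edge.\<close>
    have split: "card V * \<Delta> = card V' * \<Delta> + (card N + card K) * \<Delta>"
      "card E + card M * \<Delta>\<^sup>2 = (card E' + card M' * \<Delta>\<^sup>2) + (card (E - E') + \<Delta>\<^sup>2)"
      using VV' EE' cM by (simp_all add: algebra_simps)
    have "card V * \<Delta> \<le> card E + card M * \<Delta>\<^sup>2"
      using split le' lb gap by linarith
    moreover have "biclique_union \<Delta> V E" if eq: "card V * \<Delta> = card E + card M * \<Delta>\<^sup>2"
    proof -
      \<comment> \<open>Three nonnegative slacks add up to zero: that of the induction hypothesis,
        the surplus of deleted edges over \<open>card N * card K\<close>, and the product in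
        \<open>gap\<close>.\<close>
      have 1: "card V' * \<Delta> = card E' + card M' * \<Delta>\<^sup>2"
        and 2: "card (E - E') = card N * card K"
        and 3: "(\<Delta> - card N) * (\<Delta> - card K) = 0"
        using split le' lb gap eq by linarith+
      have EE: "E - E' = biclique N K"
        using card_seteq[OF _ sub] finE 2 card_biclique[OF NK] by simp
      have E'disj: "e \<inter> (N \<union> K) = {}" if "e \<in> E'" for e
        using E'V'[OF that] by (auto simp: V'_def)
      have comp: "biclique_component E N K"
      proof -
        have "{e \<in> E. e \<inter> (N \<union> K) \<noteq> {}} = E - E'"
          using E'disj by (auto simp: E'_def)
        then show ?thesis using NK EE by (simp add: biclique_component_def)
      qed
      have "\<exists>A B. biclique_component E A B \<and> card A = \<Delta> \<and> card B \<in> {1..\<Delta>} \<and> w \<in> A \<union> B"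
        if w: "w \<in> V" for w
      proof (cases "w \<in> V'")
        case True
        then obtain A B where AB: "biclique_component E' A B" "card A = \<Delta>" "card B \<in> {1..\<Delta>}"
          "w \<in> A \<union> B"
          using eq'[OF 1] by (auto simp: biclique_union_def)
        then have "A \<noteq> {}" "B \<noteq> {}" by auto
        then have sub': "A \<union> B \<subseteq> V'" using biclique_component_subset[OF G' AB(1)] by simp
        \<comment> \<open>The deleted edges live inside \<open>N \<union> K\<close>, so restoring
          them does not affect a component found in the smaller graph.\<close>
        have "e \<inter> (A \<union> B) = {}" if "e \<in> E - E'" for e
        proof -
          have "e \<subseteq> N \<union> K" using that unfolding EE by (auto simp: biclique_def)
          then show ?thesis using sub' by (auto simp: V'_def)
        qed
        then have "{e \<in> E. e \<inter> (A \<union> B) \<noteq> {}} = {e \<in> E'. e \<inter> (A \<union> B) \<noteq> {}}"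
          by (auto simp: E'_def)
        then show ?thesis using AB by (auto simp: biclique_component_def)
      next
        case False
        then have wNK: "w \<in> N \<union> K" using w by (simp add: V'_def)
        have "card K \<ge> 1" using uK finK by (metis card_0_eq empty_iff less_one not_le)
        \<comment> \<open>Whichever of \<open>N\<close> and \<open>K\<close> has
          \<open>\<Delta>\<close> vertices serves as the first side; the other has between 1 and
          \<open>\<Delta>\<close>.\<close>
        from 3 have "card N = \<Delta> \<or> card K = \<Delta>" using dle kle by auto
        then show ?thesis
        proof
          assume "card N = \<Delta>"
          then show ?thesis using comp wNK kle \<open>card K \<ge> 1\<close> by auto
        next
          assume "card K = \<Delta>"
          moreover have "biclique_component E K N"
            using comp biclique_component_commute by blast
          ultimately show ?thesis using wNK dle \<open>card N \<ge> 1\<close> by auto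
        qed
      qed
      then show ?thesis by (simp add: biclique_union_def)
    qed
    ultimately show ?thesis using M by blast
  qed
qed

section \<open>The reverse inequality for unions of bicliques\<close>

text \<open>Edges \<open>{a, b}\<close> and \<open>{c, d}\<close> could be traded for
  \<open>{a, d}\<close> and \<open>{c, b}\<close>, giving another matching on the same
  vertices.\<close>

lemma uniquely_restricted_biclique_edge_unique:
  assumes M: "uniquely_restricted E M" and AB: "A \<inter> B = {}" "biclique A B \<subseteq> E"
    and ef: "e \<in> M" "f \<in> M" "e \<in> biclique A B" "f \<in> biclique A B"
  shows "e = f"
proof (rule ccontr)
  assume ne: "e \<noteq> f"
  obtain a b c d where e: "e = {a, b}" "a \<in> A" "b \<in> B" and f: "f = {c, d}" "c \<in> A" "d \<in> B"
    using ef by (auto simp: biclique_def)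
  have disj: "\<And>e f. e \<in> M \<Longrightarrow> f \<in> M \<Longrightarrow> e \<noteq> f \<Longrightarrow> e \<inter> f = {}" and ME: "M \<subseteq> E"
    using M by (auto simp: uniquely_restricted_def is_matching_def)
  have ne4: "a \<noteq> c" "b \<noteq> d" "a \<noteq> d" "c \<noteq> b" using disj[OF ef(1,2) ne] e f by auto
  let ?R = "M - {e, f}"
  let ?M = "insert {a, d} (insert {c, b} ?R)"
  have "{a, d} \<in> E" "{c, b} \<in> E" using AB(2) e f by (auto simp: biclique_def)
  moreover have avoid: "g \<inter> {a, b, c, d} = {}" if "g \<in> ?R" for g
    using disj[of g e] disj[of g f] that ef e f by auto
  ultimately have "is_matching E ?M"
    unfolding is_matching_def using disj ME ne4 e(2,3) f(2,3) AB(1)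
    by (auto 0 3)
  moreover have "\<Union>?M = \<Union>M" using ef e f by auto
  ultimately have "?M = M" using M by (simp add: uniquely_restricted_def)
  \<comment> \<open>This edge shares \<open>a\<close> with \<open>e\<close> but differs from it, as
    \<open>b \<noteq> d\<close>.\<close>
  then have "{a, d} \<in> M" by blast
  then show False using disj[OF _ ef(1), of "{a, d}"] e f ne4 by (auto simp: doubleton_eq_iff)
qed

text \<open>A component with sides of sizes \<open>\<Delta>\<close> and \<open>r\<close> has
  \<open>\<Delta> * r\<close> edges and at most one matching edge, which balances its
  \<open>\<Delta> + r\<close> vertices:
  \<open>\<Delta> * r + \<Delta>\<^sup>2 = (\<Delta> + r) * \<Delta>\<close>. The induction removes
  one component at a time.\<close>

lemma uniquely_restricted_card_le_if_biclique_union: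
  assumes "simple_graph V E" "biclique_union \<Delta> V E" "uniquely_restricted E M" "\<Delta> > 0"
  shows "card E + card M * \<Delta>\<^sup>2 \<le> card V * \<Delta>"
  using assms
proof (induction "card V" arbitrary: V E M rule: less_induct)
  case less
  note G = less.prems(1) and M = less.prems(3)
  have finV: "finite V" using G by (simp add: simple_graph_def)
  have finE: "finite E" by (rule simple_graph_finite_edges[OF G])
  have ME: "M \<subseteq> E" and disj: "\<And>e f. e \<in> M \<Longrightarrow> f \<in> M \<Longrightarrow> e \<noteq> f \<Longrightarrow> e \<inter> f = {}"
    using M by (auto simp: uniquely_restricted_def is_matching_def)
  show ?case
  proof (cases "V = {}")
    case True
    then have "E = {}" using G by (force simp: simple_graph_def)
    then show ?thesis using True ME by simp
  next
    case False
    then obtain A B where AB: "biclique_component E A B" and cA: "card A = \<Delta>"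
      and cB: "card B \<in> {1..\<Delta>}"
      using less.prems(2) by (fastforce simp: biclique_union_def)
    have ne: "A \<noteq> {}" "B \<noteq> {}" using cA cB \<open>\<Delta> > 0\<close> by auto
    have sub: "A \<union> B \<subseteq> V" by (rule biclique_component_subset[OF G AB ne])
    have finAB: "finite A" "finite B" using sub finV finite_subset by auto
    have dAB: "A \<inter> B = {}" and EAB: "{e \<in> E. e \<inter> (A \<union> B) \<noteq> {}} = biclique A B"
      using AB by (auto simp: biclique_component_def)
    have bsub: "biclique A B \<subseteq> E" using EAB by blast
    define V' where "V' = V - (A \<union> B)"
    define E' where "E' = E - biclique A B"
    have E'dis: "e \<inter> (A \<union> B) = {}" if "e \<in> E'" for e using that EAB by (auto simp: E'_def)
    have bAB: "e \<subseteq> A \<union> B" if "e \<in> biclique A B" for e using that by (auto simp: biclique_def)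
    have G': "simple_graph V' E'"
      using G E'dis by (fastforce simp: simple_graph_def V'_def E'_def)
    have bu': "biclique_union \<Delta> V' E'"
      unfolding biclique_union_def
    proof
      fix w assume w: "w \<in> V'"
      then obtain C D where CD: "biclique_component E C D" "card C = \<Delta>" "card D \<in> {1..\<Delta>}"
        "w \<in> C \<union> D"
        using less.prems(2) by (auto simp: biclique_union_def V'_def)
      have CDE: "{e \<in> E. e \<inter> (C \<union> D) \<noteq> {}} = biclique C D"
        using CD(1) by (auto simp: biclique_component_def)
      have ne': "C \<noteq> {}" "D \<noteq> {}" using CD \<open>\<Delta> > 0\<close> by auto
      have wAB: "w \<notin> A \<union> B" using w by (simp add: V'_def)
      \<comment> \<open>An edge meeting both bicliques spreads \<open>A \<union> B\<close> over all of \<open>C \<union> D\<close>, including \<open>w\<close>.\<close>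
      have dis: "e \<inter> (C \<union> D) = {}" if e: "e \<in> biclique A B" for e
      proof (rule ccontr)
        assume "e \<inter> (C \<union> D) \<noteq> {}"
        then have "e \<in> biclique C D" using CDE e bsub by blast
        then obtain c d where cd: "e = {c, d}" "c \<in> C" "d \<in> D" by (auto simp: biclique_def)
        then have cdAB: "c \<in> A \<union> B" "d \<in> A \<union> B" using bAB[OF e] by auto
        have E2: "f \<subseteq> A \<union> B" if "f \<in> biclique C D" "f \<inter> (A \<union> B) \<noteq> {}" for f
          using that EAB CDE bAB by blast
        have "{c, y} \<subseteq> A \<union> B" if "y \<in> D" for y
          using that cd cdAB by (intro E2) (auto simp: biclique_def)
        moreover have "{y, d} \<subseteq> A \<union> B" if "y \<in> C" for y
          using that cd cdAB by (intro E2) (auto simp: biclique_def)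
        ultimately show False using CD(4) wAB by auto
      qed
      have "{e \<in> E'. e \<inter> (C \<union> D) \<noteq> {}} = {e \<in> E. e \<inter> (C \<union> D) \<noteq> {}}"
      proof (rule Collect_cong)
        show "e \<in> E' \<and> e \<inter> (C \<union> D) \<noteq> {} \<longleftrightarrow> e \<in> E \<and> e \<inter> (C \<union> D) \<noteq> {}" for e
          using dis[of e] unfolding E'_def by blast
      qed
      then have "{e \<in> E'. e \<inter> (C \<union> D) \<noteq> {}} = biclique C D" using CDE by (rule trans)
      moreover have "C \<inter> D = {}" using CD(1) by (simp add: biclique_component_def)
      ultimately have "biclique_component E' C D" unfolding biclique_component_def by simp
      then show "\<exists>A B. biclique_component E' A B \<and> card A = \<Delta> \<and> card B \<in> {1..\<Delta>} \<and> w \<in> A \<union> B"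
        using CD by blast
    qed
    define M' where "M' = M \<inter> E'"
    have M': "uniquely_restricted E' M'"
      unfolding uniquely_restricted_def
    proof (intro conjI allI impI)
      show "is_matching E' M'" unfolding M'_def is_matching_def using disj by blast
      fix M2 assume M2: "is_matching E' M2 \<and> \<Union>M2 = \<Union>M'"
      \<comment> \<open>A rival of \<open>M'\<close> becomes a rival of \<open>M\<close> once the
        edges of \<open>M\<close> inside the removed component are put back.\<close>
      let ?M = "M2 \<union> (M - E')"
      have MB: "e \<in> biclique A B" if "e \<in> M - E'" for e using that ME by (auto simp: E'_def)
      have cross: "e \<inter> f = {}" if "e \<in> M2" "f \<in> M - E'" for e f
        using that M2 E'dis[of e] bAB[OF MB[OF that(2)]] by (auto simp: is_matching_def)
      have "is_matching E ?M"
        unfolding is_matching_def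
      proof (intro conjI ballI impI)
        show "?M \<subseteq> E" using M2 ME by (auto simp: is_matching_def E'_def)
        fix e f assume "e \<in> ?M" "f \<in> ?M" "e \<noteq> f"
        then show "e \<inter> f = {}"
          using M2 disj[of e f] cross[of e f] cross[of f e] unfolding is_matching_def by blast
      qed
      moreover have "\<Union>?M = \<Union>M" using M2 by (auto simp: M'_def)
      ultimately have "?M = M" using M by (simp add: uniquely_restricted_def)
      then show "M2 = M'" using M2 by (auto simp: M'_def is_matching_def)
    qed
    have "card (A \<union> B) = \<Delta> + card B" using card_Un_disjoint[OF finAB dAB] cA by simp
    then have VV': "card V = card V' + (\<Delta> + card B)"
      unfolding V'_def using card_mono[OF finV sub] finAB sub
      by (subst card_Diff_subset) auto
    have EE': "card E = card E' + \<Delta> * card B"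
      unfolding E'_def using bsub finE card_biclique[OF dAB] cA card_mono[OF finE bsub]
      by (subst card_Diff_subset) (auto simp: finite_subset)
    have MM': "card M \<le> card M' + 1"
    proof -
      have "card (M - E') \<le> 1"
      proof (rule ccontr)
        assume "\<not> card (M - E') \<le> 1"
        \<comment> \<open>An infinite set has \<open>card\<close> 0, so a cardinality above 1 also
          yields finiteness.\<close>
        then obtain e f where "e \<in> M - E'" "f \<in> M - E'" "e \<noteq> f"
          by (metis One_nat_def card_le_Suc0_iff_eq card.infinite zero_le)
        then show False
          using uniquely_restricted_biclique_edge_unique[OF M dAB bsub, of e f] ME
          by (auto simp: E'_def)
      qed
      moreover have "card M \<le> card M' + card (M - E')"
        unfolding M'_def by (metis Int_Diff_Un card_Un_le)
      ultimately show ?thesis by linarith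
    qed
    have "card V' < card V" using VV' \<open>\<Delta> > 0\<close> by simp
    from less.hyps[OF this G' bu' M' \<open>\<Delta> > 0\<close>]
    have IH: "card E' + card M' * \<Delta>\<^sup>2 \<le> card V' * \<Delta>" .
    have "card M * \<Delta>\<^sup>2 \<le> (card M' + 1) * \<Delta>\<^sup>2" using MM' by (rule mult_le_mono1)
    then show ?thesis using IH VV' EE' by (simp add: algebra_simps power2_eq_square)
  qed
qed

section \<open>Isomorphism with a complete bipartite graph\<close>

text \<open>The sides are the preimages of the \<open>Inl\<close> and \<open>Inr\<close> vertices;
  conversely, enumerations of the two sides combine to an isomorphism. The condition on
  \<open>F\<close> matters because \<open>graph_isomorphic\<close> only tests sets
  \<open>{u, v}\<close> with both vertices in \<open>C\<close>.\<close>

lemma graph_isomorphic_biclique_iff: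
  assumes "finite C" and F: "\<And>e. e \<in> F \<Longrightarrow> card e = 2 \<and> e \<subseteq> C"
  shows "graph_isomorphic C F (K_verts a b) (K_edges a b) \<longleftrightarrow>
    (\<exists>A B. A \<inter> B = {} \<and> A \<union> B = C \<and> card A = a \<and> card B = b \<and> F = biclique A B)"
proof
  assume "graph_isomorphic C F (K_verts a b) (K_edges a b)"
  then obtain f where f: "bij_betw f C (K_verts a b)"
    and fe: "\<And>u v. u \<in> C \<Longrightarrow> v \<in> C \<Longrightarrow> {u, v} \<in> F \<longleftrightarrow> {f u, f v} \<in> K_edges a b"
    unfolding graph_isomorphic_def by blast
  have fin: "f v \<in> K_verts a b" if "v \<in> C" for v using f that by (auto simp: bij_betw_def)
  define A where "A = {v \<in> C. f v \<in> Inl ` {..<a}}"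
  define B where "B = {v \<in> C. f v \<in> Inr ` {..<b}}"
  have dis: "A \<inter> B = {}" by (auto simp: A_def B_def)
  have un: "A \<union> B = C" using fin by (auto simp: A_def B_def K_verts_def Plus_def)
  have "bij_betw f A (Inl ` {..<a})" "bij_betw f B (Inr ` {..<b})"
    using f by (auto simp: A_def B_def bij_betw_def inj_on_def K_verts_def Plus_def image_iff)
       (metis (no_types, lifting) Un_iff imageE image_eqI lessThan_iff)+
  then have cA: "card A = a" and cB: "card B = b"
    by (auto dest!: bij_betw_same_card simp: card_image)
  have "F = biclique A B"
  proof
    show "biclique A B \<subseteq> F"
    proof
      fix e assume "e \<in> biclique A B"
      then obtain x y where xy: "e = {x, y}" "x \<in> A" "y \<in> B" by (auto simp: biclique_def)
      then obtain i j where "f x = Inl i" "f y = Inr j" "i < a" "j < b"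
        by (auto simp: A_def B_def)
      then have "{f x, f y} \<in> K_edges a b" by (auto simp: K_edges_def)
      then show "e \<in> F" using fe[of x y] xy by (auto simp: A_def B_def)
    qed
    show "F \<subseteq> biclique A B"
    proof
      fix e assume "e \<in> F"
      then obtain x y where xy: "e = {x, y}" "x \<in> C" "y \<in> C"
        using F[of e] by (auto simp: card_2_iff)
      then obtain i j where ij: "{f x, f y} = {Inl i, Inr j}" "i < a" "j < b"
        using fe[of x y] \<open>e \<in> F\<close> by (auto simp: K_edges_def)
      then have "(x \<in> A \<and> y \<in> B) \<or> (y \<in> A \<and> x \<in> B)"
        using xy by (auto simp: A_def B_def doubleton_eq_iff)
      then show "e \<in> biclique A B" using xy by (auto simp: biclique_def insert_commute)
    qed
  qed
  then show "\<exists>A B. A \<inter> B = {} \<and> A \<union> B = C \<and> card A = a \<and> card B = b \<and> F = biclique A B"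
    using dis un cA cB by blast
next
  assume "\<exists>A B. A \<inter> B = {} \<and> A \<union> B = C \<and> card A = a \<and> card B = b \<and> F = biclique A B"
  then obtain A B where dis: "A \<inter> B = {}" and un: "A \<union> B = C" and cA: "card A = a"
    and cB: "card B = b" and FB: "F = biclique A B" by blast
  have "finite A" "finite B" using un \<open>finite C\<close> by auto
  then obtain g h where g: "bij_betw g A {..<a}" and h: "bij_betw h B {..<b}"
    using cA cB ex_bij_betw_finite_nat by (metis atLeast0LessThan)
  define f where "f v = (if v \<in> A then Inl (g v) else Inr (h v))" for v
  have fA: "f v = Inl (g v)" "g v < a" if "v \<in> A" for v
    using that g by (auto simp: f_def bij_betw_def)
  have fB: "f v = Inr (h v)" "h v < b" if "v \<in> B" for v
    using that h dis by (auto simp: f_def bij_betw_def)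
  have bij: "bij_betw f C (K_verts a b)"
  proof -
    have "bij_betw f A (Inl ` {..<a})"
      using g fA by (auto simp: bij_betw_def inj_on_def image_iff)
    moreover have "bij_betw f B (Inr ` {..<b})"
      using h fB by (auto simp: bij_betw_def inj_on_def image_iff)
    ultimately have "bij_betw f (A \<union> B) (Inl ` {..<a} \<union> Inr ` {..<b})"
      by (rule bij_betw_combine) auto
    then show ?thesis by (simp add: un K_verts_def Plus_def)
  qed
  have "{u, v} \<in> F \<longleftrightarrow> {f u, f v} \<in> K_edges a b" if "u \<in> C" "v \<in> C" for u v
  proof -
    have "{u, v} \<in> F \<longleftrightarrow> (u \<in> A \<and> v \<in> B) \<or> (v \<in> A \<and> u \<in> B)"
      unfolding FB biclique_def by (auto simp: doubleton_eq_iff)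
    also have "\<dots> \<longleftrightarrow> {f u, f v} \<in> K_edges a b"
      using that un fA fB dis unfolding K_edges_def by (auto simp: doubleton_eq_iff)
    finally show ?thesis .
  qed
  then show "graph_isomorphic C F (K_verts a b) (K_edges a b)"
    unfolding graph_isomorphic_def using bij by blast
qed

section \<open>Connected components\<close>

lemma graph_components_eq: "graph_components V E = (\<lambda>v. {w \<in> V. reachable E v w}) ` V"
  by (auto simp: graph_components_def quotient_def)

lemma component_edge_closed:
  assumes G: "simple_graph V E" and C: "C \<in> graph_components V E"
    and e: "e \<in> E" "e \<inter> C \<noteq> {}"
  shows "e \<subseteq> C"
proof -
  obtain v where v: "C = {w \<in> V. reachable E v w}" using C by (auto simp: graph_components_eq)
  obtain x where x: "x \<in> e" "x \<in> C" using e by blast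
  obtain y where y: "e = {x, y}" "y \<in> V" using simple_graph_edgeE[OF G e(1) x(1)] by blast
  have "reachable E v y"
    using x y e v by (auto simp: reachable_def intro: rtrancl_into_rtrancl)
  then show ?thesis using x y v by auto
qed

text \<open>No edge leaves \<open>A \<union> B\<close>, so nothing else is reachable; conversely,
  one fixed vertex on each side serves as a hub for reaching the whole opposite side.\<close>

lemma biclique_component_is_component:
  assumes G: "simple_graph V E" and AB: "biclique_component E A B" "A \<noteq> {}" "B \<noteq> {}"
    and v: "v \<in> A \<union> B"
  shows "{w \<in> V. reachable E v w} = A \<union> B"
proof
  let ?R = "{(x, y). {x, y} \<in> E}"
  have edge: "(a, b) \<in> ?R" "(b, a) \<in> ?R" if "a \<in> A" "b \<in> B" for a b
    using AB(1) that by (auto simp: biclique_component_def biclique_def insert_commute)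
  have "y \<in> A \<union> B" if "(v, y) \<in> ?R\<^sup>*" for y
    using that
  proof induction
    case (step y z)
    then have "{y, z} \<in> biclique A B" using AB(1) by (auto simp: biclique_component_def)
    then show ?case by (auto simp: biclique_def doubleton_eq_iff)
  qed (rule v)
  then show "{w \<in> V. reachable E v w} \<subseteq> A \<union> B" by (auto simp: reachable_def)
  obtain a b where ab: "a \<in> A" "b \<in> B" using AB by blast
  have "(v, a) \<in> ?R\<^sup>* \<and> (v, b) \<in> ?R\<^sup>*"
  proof (cases "v \<in> A")
    case True
    then have "(v, b) \<in> ?R\<^sup>*" using edge ab by blast
    then show ?thesis using rtrancl_into_rtrancl[OF _ edge(2)[OF ab]] by blast
  next
    case False
    then have "(v, a) \<in> ?R\<^sup>*" using v edge ab by blast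
    then show ?thesis using rtrancl_into_rtrancl[OF _ edge(1)[OF ab]] by blast
  qed
  then have "(v, w) \<in> ?R\<^sup>*" if "w \<in> A \<union> B" for w
    using that rtrancl_into_rtrancl[OF _ edge(1)[OF ab(1)]]
      rtrancl_into_rtrancl[OF _ edge(2)[OF _ ab(2)]] by blast
  then show "A \<union> B \<subseteq> {w \<in> V. reachable E v w}"
    using biclique_component_subset[OF G AB] by (auto simp: reachable_def)
qed

text \<open>The component of a vertex and the biclique around it are the same vertex set, so a
  condition per vertex and a condition per component agree.\<close>

lemma biclique_union_iff_components:
  assumes G: "simple_graph V E" and "\<Delta> > 0"
  shows "biclique_union \<Delta> V E \<longleftrightarrow>
    (\<forall>C \<in> graph_components V E. \<exists>r \<in> {1..\<Delta>}.
        graph_isomorphic C (induced_edges E C) (K_verts \<Delta> r) (K_edges \<Delta> r))"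
proof -
  have iso: "graph_isomorphic C (induced_edges E C) (K_verts \<Delta> r) (K_edges \<Delta> r) \<longleftrightarrow>
      (\<exists>A B. biclique_component E A B \<and> A \<union> B = C \<and> card A = \<Delta> \<and> card B = r)"
    if C: "C \<in> graph_components V E" for C r
  proof -
    have "C \<subseteq> V" using C by (auto simp: graph_components_eq)
    then have "finite C" using G finite_subset by (auto simp: simple_graph_def)
    moreover have "card e = 2 \<and> e \<subseteq> C" if "e \<in> induced_edges E C" for e
      using that G by (auto simp: induced_edges_def simple_graph_def)
    ultimately have "graph_isomorphic C (induced_edges E C) (K_verts \<Delta> r) (K_edges \<Delta> r) \<longleftrightarrow>
      (\<exists>A B. A \<inter> B = {} \<and> A \<union> B = C \<and> card A = \<Delta> \<and> card B = r \<and>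
        induced_edges E C = biclique A B)"
      by (rule graph_isomorphic_biclique_iff)
    \<comment> \<open>Edges are nonempty and never leave a component, so lying inside
      \<open>C\<close> and meeting \<open>C\<close> coincide.\<close>
    moreover have "induced_edges E C = {e \<in> E. e \<inter> C \<noteq> {}}"
    proof -
      have "e \<subseteq> C \<longleftrightarrow> e \<inter> C \<noteq> {}" if "e \<in> E" for e
      proof -
        have "e \<noteq> {}" using G that by (auto simp: simple_graph_def)
        then show ?thesis using component_edge_closed[OF G C that] by blast
      qed
      then show ?thesis unfolding induced_edges_def by (metis (lifting))
    qed
    then have "A \<inter> B = {} \<and> A \<union> B = C \<and> card A = \<Delta> \<and> card B = r \<and>
        induced_edges E C = biclique A B \<longleftrightarrow>
      biclique_component E A B \<and> A \<union> B = C \<and> card A = \<Delta> \<and> card B = r" for A B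
      unfolding biclique_component_def by (cases "A \<union> B = C") (simp_all add: conj_ac)
    ultimately show ?thesis by simp
  qed
  show ?thesis
  proof
    assume bu: "biclique_union \<Delta> V E"
    show "\<forall>C \<in> graph_components V E. \<exists>r \<in> {1..\<Delta>}.
        graph_isomorphic C (induced_edges E C) (K_verts \<Delta> r) (K_edges \<Delta> r)"
    proof
      fix C assume C: "C \<in> graph_components V E"
      then obtain v where v: "v \<in> V" "C = {w \<in> V. reachable E v w}"
        by (auto simp: graph_components_eq)
      then obtain A B where AB: "biclique_component E A B" "card A = \<Delta>" "card B \<in> {1..\<Delta>}"
        "v \<in> A \<union> B" using bu by (auto simp: biclique_union_def)
      then have "A \<noteq> {}" "B \<noteq> {}" using \<open>\<Delta> > 0\<close> by auto
      then have "A \<union> B = C" using biclique_component_is_component[OF G AB(1)] AB(4) v by simp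
      then show "\<exists>r \<in> {1..\<Delta>}.
        graph_isomorphic C (induced_edges E C) (K_verts \<Delta> r) (K_edges \<Delta> r)"
        using iso[OF C] AB by blast
    qed
  next
    assume *: "\<forall>C \<in> graph_components V E. \<exists>r \<in> {1..\<Delta>}.
        graph_isomorphic C (induced_edges E C) (K_verts \<Delta> r) (K_edges \<Delta> r)"
    show "biclique_union \<Delta> V E"
      unfolding biclique_union_def
    proof
      fix v assume v: "v \<in> V"
      let ?C = "{w \<in> V. reachable E v w}"
      have C: "?C \<in> graph_components V E" using v by (simp add: graph_components_eq)
      have "v \<in> ?C" using v by (simp add: reachable_def)
      then show "\<exists>A B. biclique_component E A B \<and> card A = \<Delta> \<and> card B \<in> {1..\<Delta>} \<and> v \<in> A \<union> B"
        using * C iso[OF C] by metis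
    qed
  qed
qed

section \<open>Maximum matchings and the bound over the reals\<close>

lemma finite_uniquely_restricted_cards:
  assumes "finite E"
  shows "finite (card ` {M. uniquely_restricted E M})"
proof -
  have "{M. uniquely_restricted E M} \<subseteq> Pow E"
    by (auto simp: uniquely_restricted_def is_matching_def)
  then show ?thesis using assms by (meson finite_Pow_iff finite_imageI finite_subset)
qed

lemma uniquely_restricted_card_le_nu_ur:
  assumes "finite E" "uniquely_restricted E M"
  shows "card M \<le> nu_ur E"
  unfolding nu_ur_def using finite_uniquely_restricted_cards[OF assms(1)] assms(2)
  by (intro Max_ge) auto

text \<open>\<open>Max\<close> is attained only on a nonempty finite set; the given \<open>M\<close>
  supplies the nonemptiness.\<close>

lemma nu_ur_attained:
  assumes "finite E" "uniquely_restricted E M"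
  shows "\<exists>M'. uniquely_restricted E M' \<and> card M' = nu_ur E"
  using Max_in[OF finite_uniquely_restricted_cards[OF assms(1)]] assms(2)
  unfolding nu_ur_def by fastforce

theorem theorem1:
  fixes V :: "'a set" and E :: "'a set set" and \<Delta> :: nat
  assumes "\<Delta> > 0"
    and "simple_graph V E"
    and "max_degree V E \<le> \<Delta>"
    and "\<not> (\<exists>v. isolated V E v)"
  shows "real (nu_ur E) \<ge> real (card V) / real \<Delta> - real (card E) / (real \<Delta>)\<^sup>2 \<and>
    (real (nu_ur E) = real (card V) / real \<Delta> - real (card E) / (real \<Delta>)\<^sup>2 \<longleftrightarrow>
      (\<forall>C \<in> graph_components V E. \<exists>r \<in> {1..\<Delta>}.
        graph_isomorphic C (induced_edges E C) (K_verts \<Delta> r) (K_edges \<Delta> r)))"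
proof -
  note G = assms(2)
  have finE: "finite E" by (rule simple_graph_finite_edges[OF G])
  have finV: "finite V" using G by (simp add: simple_graph_def)
  have deg: "vertex_degree E v \<in> {1..\<Delta>}" if "v \<in> V" for v
  proof -
    have "vertex_degree E v \<le> max_degree V E"
      unfolding max_degree_def using finV that by (intro Max_ge) auto
    then show ?thesis using assms(3,4) that by (auto simp: isolated_def Suc_le_eq)
  qed
  obtain M where M: "uniquely_restricted E M" "card V * \<Delta> \<le> card E + card M * \<Delta>\<^sup>2"
    and eqM: "card V * \<Delta> = card E + card M * \<Delta>\<^sup>2 \<Longrightarrow> biclique_union \<Delta> V E"
    using exists_large_uniquely_restricted[OF G deg] by blast
  have mono: "card M * \<Delta>\<^sup>2 \<le> nu_ur E * \<Delta>\<^sup>2"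
    using uniquely_restricted_card_le_nu_ur[OF finE M(1)] by (rule mult_le_mono1)
  have le: "card V * \<Delta> \<le> card E + nu_ur E * \<Delta>\<^sup>2" using M(2) mono by linarith
  have eq: "card V * \<Delta> = card E + nu_ur E * \<Delta>\<^sup>2 \<longleftrightarrow> biclique_union \<Delta> V E"
  proof
    assume "card V * \<Delta> = card E + nu_ur E * \<Delta>\<^sup>2"
    \<comment> \<open>The value for \<open>M\<close> lies between the two equal sides, so
      \<open>M\<close> itself attains equality.\<close>
    then show "biclique_union \<Delta> V E" using eqM M(2) mono by linarith
  next
    assume bu: "biclique_union \<Delta> V E"
    obtain M' where "uniquely_restricted E M'" "card M' = nu_ur E"
      using nu_ur_attained[OF finE M(1)] by blast
    then show "card V * \<Delta> = card E + nu_ur E * \<Delta>\<^sup>2"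
      using uniquely_restricted_card_le_if_biclique_union[OF G bu _ \<open>\<Delta> > 0\<close>, of M'] le by simp
  qed
  have D: "real \<Delta> > 0" using \<open>\<Delta> > 0\<close> by simp
  \<comment> \<open>Over the common denominator, the real bound becomes the natural number
    inequality divided by \<open>\<Delta>\<^sup>2\<close>.\<close>
  have bound: "real (card V) / real \<Delta> - real (card E) / (real \<Delta>)\<^sup>2 =
      (real (card V * \<Delta>) - real (card E)) / (real \<Delta>)\<^sup>2"
    using D by (simp add: field_simps power2_eq_square)
  have rle: "real (card V * \<Delta>) \<le> real (card E) + real (nu_ur E) * (real \<Delta>)\<^sup>2"
    using le by (metis of_nat_add of_nat_le_iff of_nat_mult of_nat_power)
  have req: "real (card V * \<Delta>) = real (card E) + real (nu_ur E) * (real \<Delta>)\<^sup>2 \<longleftrightarrow>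
      biclique_union \<Delta> V E"
    using eq by (metis of_nat_add of_nat_eq_iff of_nat_mult of_nat_power)
  have "real (card V) / real \<Delta> - real (card E) / (real \<Delta>)\<^sup>2 \<le> real (nu_ur E)"
    unfolding bound using rle D by (simp add: pos_divide_le_eq)
  moreover have "real (nu_ur E) = real (card V) / real \<Delta> - real (card E) / (real \<Delta>)\<^sup>2 \<longleftrightarrow>
      biclique_union \<Delta> V E"
    unfolding bound using req D by (auto simp: eq_divide_eq)
  ultimately show ?thesis using biclique_union_iff_components[OF G \<open>\<Delta> > 0\<close>] by blast
qed

end
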